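(* Let $\Omega$ be an uncountable locally compact Polish space and let $\kappa$ be an ordinal of cardinality $\mathfrak{c}$. Then there exists a well-ordered decreasing chain $(\mathcal{Q}_\alpha:\alpha\in\kappa)$ of prime $z$-filters on $\Omega$. Furthermore, (for this chain) by setting $Q_\alpha=C_0(\Omega)\cap\mathbf{Z}^{-1}[\mathcal{Q}_\alpha]$ one obtains a well-ordered decreasing chain $(Q_\alpha:\alpha\in\kappa)$ of prime $z$-ideals in $C_0(\Omega)$.
   Context: $\mathfrak{c}=2^{\aleph_0}$. A Polish space is a separable completely metrizable space. A well-ordered decreasing chain indexed by an ordinal $\kappa$ means a family with $\mathcal{Q}_\beta\subsetneq\mathcal{Q}_\alpha$ whenever $\alpha<\beta$ in $\kappa$. $C(\Omega)$ is the algebra of continuous scalar-valued functions on $\Omega$ and $C_0(\Omega)$ the subalgebra of those vanishing at infinity (scalar field real or complex, fixed). $\mathbf{Z}(f)=f^{-1}(0)$ and $\mathbf{Z}[\Omega]=\{\mathbf{Z}(f):f\in C(\Omega)\}$. A $z$-filter on $\Omega$ is a non-empty proper subset of $\mathbf{Z}[\Omega]$ closed under finite intersections and under supersets belonging to $\mathbf{Z}[\Omega]$. A $z$-filter $\mathcal{P}$ is prime if $Z_1\cup Z_2\notin\mathcal{P}$ whenever $Z_1,Z_2\in\mathbf{Z}[\Omega]\setminus\mathcal{P}$. For a $z$-filter $\mathcal{F}$, $\mathbf{Z}^{-1}[\mathcal{F}]=\{f\in C(\Omega):\mathbf{Z}(f)\in\mathcal{F}\}$. An ideal $I$ of $C_0(\Omega)$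 is a $z$-ideal if $g\in I$ whenever $g\in C_0(\Omega)$, $f\in I$ and $\mathbf{Z}(g)\supset\mathbf{Z}(f)$. Prime ideals are proper. *)

theory Defs
  imports "HOL-Analysis.Analysis"
begin

unbundle cardinal_syntax

definition polish_topology :: "'a topology \<Rightarrow> bool" where
  "polish_topology X \<longleftrightarrow> separable_space X \<and> completely_metrizable_space X"

text \<open>
  The scalar field is a type \<open>'k::real_normed_field\<close>; the instances \<open>real\<close> and \<open>complex\<close> are the
  intended ones, and by Gelfand--Mazur they are the only ones up to isomorphism.
  Functions on the space \<open>X\<close> are represented extensionally (\<open>undefined\<close> outside
  \<open>topspace X\<close>), so that equality of representatives is equality of functions on \<open>X\<close>.
\<close>

definition cont_functions :: "'a topology \<Rightarrow> ('a \<Rightarrow> 'k::real_normed_field) set" where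
  "cont_functions X = {f \<in> extensional (topspace X). continuous_map X euclidean f}"

definition C0_functions :: "'a topology \<Rightarrow> ('a \<Rightarrow> 'k::real_normed_field) set" where
  "C0_functions X = {f \<in> cont_functions X.
     \<forall>\<epsilon>>0. \<exists>K. compactin X K \<and> (\<forall>x \<in> topspace X - K. norm (f x) < \<epsilon>)}"

definition zero_set :: "'a topology \<Rightarrow> ('a \<Rightarrow> 'k::real_normed_field) \<Rightarrow> 'a set" where
  "zero_set X f = {x \<in> topspace X. f x = 0}"

definition zero_sets :: "'k::real_normed_field itself \<Rightarrow> 'a topology \<Rightarrow> 'a set set" where
  "zero_sets _ X = zero_set X ` (cont_functions X :: ('a \<Rightarrow> 'k) set)"

definition z_filter :: "'k::real_normed_field itself \<Rightarrow> 'a topology \<Rightarrow> 'a set set \<Rightarrow> bool" where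
  "z_filter k X F \<longleftrightarrow> F \<noteq> {} \<and> F \<subset> zero_sets k X \<and>
     (\<forall>Z1\<in>F. \<forall>Z2\<in>F. Z1 \<inter> Z2 \<in> F) \<and>
     (\<forall>Z1\<in>F. \<forall>Z2\<in>zero_sets k X. Z1 \<subseteq> Z2 \<longrightarrow> Z2 \<in> F)"

definition prime_z_filter :: "'k::real_normed_field itself \<Rightarrow> 'a topology \<Rightarrow> 'a set set \<Rightarrow> bool" where
  "prime_z_filter k X P \<longleftrightarrow> z_filter k X P \<and>
     (\<forall>Z1 \<in> zero_sets k X - P. \<forall>Z2 \<in> zero_sets k X - P. Z1 \<union> Z2 \<notin> P)"

definition z_inverse :: "'a topology \<Rightarrow> 'a set set \<Rightarrow> ('a \<Rightarrow> 'k::real_normed_field) set" where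
  "z_inverse X F = {f \<in> cont_functions X. zero_set X f \<in> F}"

text \<open>
  \<open>C0_functions X\<close> has no unit unless \<open>X\<close> is compact, so the ideals of HOL-Algebra (which live
  in unital rings) do not apply. Ideals are algebra ideals, i.e. also closed under scalars.
\<close>

definition C0_ideal :: "'a topology \<Rightarrow> ('a \<Rightarrow> 'k::real_normed_field) set \<Rightarrow> bool" where
  "C0_ideal X I \<longleftrightarrow> I \<subseteq> C0_functions X \<and>
     (\<lambda>x\<in>topspace X. 0) \<in> I \<and>
     (\<forall>f\<in>I. \<forall>g\<in>I. (\<lambda>x\<in>topspace X. f x + g x) \<in> I) \<and>
     (\<forall>c. \<forall>f\<in>I. (\<lambda>x\<in>topspace X. c * f x) \<in> I) \<and>
     (\<forall>g\<in>C0_functions X. \<forall>f\<in>I. (\<lambda>x\<in>topspace X. g x * f x) \<in> I)"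

definition C0_z_ideal :: "'a topology \<Rightarrow> ('a \<Rightarrow> 'k::real_normed_field) set \<Rightarrow> bool" where
  "C0_z_ideal X I \<longleftrightarrow> C0_ideal X I \<and>
     (\<forall>g\<in>C0_functions X. \<forall>f\<in>I. zero_set X f \<subseteq> zero_set X g \<longrightarrow> g \<in> I)"

definition C0_prime_ideal :: "'a topology \<Rightarrow> ('a \<Rightarrow> 'k::real_normed_field) set \<Rightarrow> bool" where
  "C0_prime_ideal X P \<longleftrightarrow> C0_ideal X P \<and> P \<noteq> C0_functions X \<and>
     (\<forall>f\<in>C0_functions X. \<forall>g\<in>C0_functions X.
        (\<lambda>x\<in>topspace X. f x * g x) \<in> P \<longrightarrow> f \<in> P \<or> g \<in> P)"

text \<open>
  An ordinal is represented by a well-order \<open>\<kappa>\<close> (a reflexive relation, as in \<open>Well_order\<close>); its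
  elements, the smaller ordinals, by \<open>Field \<kappa>\<close>. Hence \<open>\<alpha> < \<beta>\<close> is \<open>(\<alpha>, \<beta>) \<in> \<kappa>\<close> with \<open>\<alpha> \<noteq> \<beta>\<close>.
\<close>

definition decreasing_chain :: "'i rel \<Rightarrow> ('i \<Rightarrow> 'b set) \<Rightarrow> bool" where
  "decreasing_chain \<kappa> Q \<longleftrightarrow> (\<forall>\<alpha> \<beta>. (\<alpha>, \<beta>) \<in> \<kappa> \<and> \<alpha> \<noteq> \<beta> \<longrightarrow> Q \<beta> \<subset> Q \<alpha>)"

end

theory Submission
  imports Defs
begin

text \<open>
  In a metrizable space the zero sets are the closed sets, so the prime \<open>z\<close>-filters needed are
  prime filters of closed sets. Embed the Cantor space \<open>nat \<Rightarrow> bool\<close> by a map \<open>e\<close> into an open set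
  \<open>V\<close> lying in a compact set, and for an almost disjoint family \<open>N\<close> of \<open>2^\<aleph>\<^sub>0\<close> many infinite subsets of
  \<open>nat\<close>, indexed by \<open>Field \<kappa>\<close>, let \<open>Z \<alpha>\<close> be the closure of the image of the points vanishing on
  \<open>N \<alpha>\<close>. On the families \<open>y\<close> of points of the Cantor space indexed by \<open>\<kappa>\<close>, the conditions
  \<open>e (y \<alpha>) \<in> Z \<alpha>\<close> and, for \<open>\<alpha> < \<beta>\<close> and open \<open>U\<close>, \<open>e (y \<beta>) \<notin> Z \<alpha>\<close> and
  \<open>e (y \<alpha>) \<in> U \<longrightarrow> e (y \<beta>) \<in> U\<close> have the finite intersection property. For an ultrafilter containing
  them, let \<open>\<Q> \<alpha>\<close> consist of the closed \<open>C\<close> with \<open>e (y \<alpha>) \<in> C\<close> for almost all \<open>y\<close>. The open sets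
  force \<open>\<Q> \<beta> \<subseteq> \<Q> \<alpha>\<close>, and \<open>Z \<alpha>\<close> separates the two. The separation survives in \<open>C\<^sub>0\<close>, since a
  closed set containing the complement of \<open>V\<close> is the zero set of a compactly supported function.
\<close>

subsection \<open>An ultrafilter on indexed families of points\<close>

text \<open>Zorn's lemma for the proper filters below \<open>F\<close>, ordered by
  \<open>\<ge>\<close>: a maximal element is a finest proper filter, and being finest forces the
  dichotomy.\<close>

lemma ultrafilter_exists:
  fixes F :: "'x filter"
  assumes "F \<noteq> bot"
  obtains U where "U \<le> F" "U \<noteq> bot"
    "\<And>P. eventually P U \<or> eventually (\<lambda>x. \<not> P x) U"
proof -
  let ?A = "{G. G \<le> F \<and> G \<noteq> bot}"
  have "\<exists>m\<in>?A. \<forall>a\<in>?A. m \<ge> a \<longrightarrow> a = m"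
  proof (rule predicate_Zorn)
    show "partial_order_on ?A (relation_of (\<ge>) ?A)"
      by (rule partial_order_on_relation_ofI) auto
  next
    fix C assume C: "C \<in> Chains (relation_of (\<ge>) ?A)"
    then have sub: "C \<subseteq> ?A" and total: "\<And>G H. G \<in> C \<Longrightarrow> H \<in> C \<Longrightarrow> G \<le> H \<or> H \<le> G"
      by (auto simp: Chains_def relation_of_def)
    show "\<exists>u\<in>?A. \<forall>a\<in>C. a \<ge> u"
    proof (cases "C = {}")
      case True
      then show ?thesis using assms by auto
    next
      case False
      \<comment> \<open>As \<open>C\<close> is a nonempty chain, whatever holds eventually for its
        infimum already does for some member, so \<open>False\<close> does not.\<close>
      have "eventually P (Inf C) \<longleftrightarrow> (\<exists>b\<in>C. eventually P b)" for P
        by (rule eventually_Inf_base) (use False total in \<open>auto simp: inf.absorb1 inf.absorb2\<close>)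
      then have "Inf C \<noteq> bot"
        using sub by (auto simp: trivial_limit_def)
      moreover have "Inf C \<le> F"
        using False sub by (auto intro: Inf_lower2)
      ultimately show ?thesis by (auto intro: Inf_lower)
    qed
  qed
  then obtain U where U: "U \<le> F" "U \<noteq> bot"
    and max: "\<And>G. G \<le> U \<Longrightarrow> G \<noteq> bot \<Longrightarrow> G = U"
    using order.trans by blast
  have "eventually P U \<or> eventually (\<lambda>x. \<not> P x) U" for P
  \<comment> \<open>Adjoining \<open>{x. P x}\<close> to \<open>U\<close> either destroys
    properness, so that the negation of \<open>P\<close> is eventually true, or changes nothing by
    maximality.\<close>
  proof (cases "inf U (principal {x. P x}) = bot")
    case True
    then show ?thesis by (simp add: trivial_limit_def eventually_inf_principal)
  next
    case False
    then have "inf U (principal {x. P x}) = U" by (intro max) auto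
    moreover have "eventually P (inf U (principal {x. P x}))"
      by (simp add: eventually_inf_principal)
    ultimately show ?thesis by simp
  qed
  with U that show thesis by blast
qed

text \<open>\<open>N t\<close> is the set of codes of finite initial segments of \<open>t\<close>.
  Two sequences differing at \<open>k\<close> share no segment longer than \<open>k\<close>.\<close>

lemma almost_disjoint_family:
  obtains N :: "(nat \<Rightarrow> bool) \<Rightarrow> nat set"
  where "\<And>t. infinite (N t)" "\<And>s t. s \<noteq> t \<Longrightarrow> finite (N s \<inter> N t)"
proof
  define N :: "(nat \<Rightarrow> bool) \<Rightarrow> nat set"
    where "N t = range (\<lambda>n. to_nat (map t [0..<n]))" for t
  show "infinite (N t)" for t
  proof -
    have "inj (\<lambda>n. to_nat (map t [0..<n]))"
      by (rule injI) (metis diff_zero length_map length_upt to_nat_split inj_eq inj_to_nat)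
    then show ?thesis unfolding N_def by (rule range_inj_infinite)
  qed
  show "finite (N s \<inter> N t)" if st: "s \<noteq> t" for s t
  proof -
    from st obtain k where k: "s k \<noteq> t k" by blast
    have "N s \<inter> N t \<subseteq> (\<lambda>n. to_nat (map s [0..<n])) ` {..k}"
    proof
      fix z assume "z \<in> N s \<inter> N t"
      then have "z \<in> N s" "z \<in> N t" by auto
      then obtain n m where z: "z = to_nat (map s [0..<n])" "z = to_nat (map t [0..<m])"
        unfolding N_def by blast
      then have eq: "map s [0..<n] = map t [0..<m]"
        by (metis inj_eq inj_to_nat)
      then have "n = m" by (metis diff_zero length_map length_upt)
      with eq k have "\<not> k < n" by auto
      with z show "z \<in> (\<lambda>n. to_nat (map s [0..<n])) ` {..k}" by auto
    qed
    then show ?thesis by (rule finite_subset) auto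
  qed
qed

text \<open>The ultrafilter conditions for indices in \<open>T\<close> and open sets in
  \<open>\<O>\<close>, with "outside \<open>Z \<alpha>\<close>" written as a nonzero coordinate in
  \<open>N \<alpha>\<close>. The clauses on the base point \<open>x\<close> are the induction
  invariant: once \<open>x\<close> becomes the point of the least index, they are the conditions
  between that point and the later ones.\<close>

definition approximating_family ::
    "'i rel \<Rightarrow> ('i \<Rightarrow> nat set) \<Rightarrow> ((nat \<Rightarrow> bool) \<Rightarrow> 'a) \<Rightarrow> 'a set set \<Rightarrow> 'i set \<Rightarrow>
      (nat \<Rightarrow> bool) \<Rightarrow> ('i \<Rightarrow> nat \<Rightarrow> bool) \<Rightarrow> bool" where
  "approximating_family r N e \<O> T x y \<longleftrightarrow> (\<forall>\<beta>\<in>T. x \<le> y \<beta> \<and> (\<forall>k\<in>N \<beta>. \<not> y \<beta> k) \<and> (\<forall>U\<in>\<O>. e x \<in> U \<longrightarrow> e (y \<beta>) \<in> U) \<and>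
    (\<forall>\<alpha>\<in>T. (\<alpha>, \<beta>) \<in> r \<and> \<alpha> \<noteq> \<beta> \<longrightarrow>
      (\<exists>k\<in>N \<alpha>. y \<beta> k) \<and> (\<forall>U\<in>\<O>. e (y \<alpha>) \<in> U \<longrightarrow> e (y \<beta>) \<in> U)))"

text \<open>
  The points \<open>y \<beta>\<close> are built by removing the least index \<open>a\<close> and switching on a late coordinate
  of \<open>N a\<close>: this leaves the zero condition for \<open>a\<close>, moves the point only slightly, and keeps
  the zero conditions of the remaining indices.
\<close>

lemma finite_approximating_family:
  fixes r :: "'i rel" and N :: "'i \<Rightarrow> nat set" and e :: "(nat \<Rightarrow> bool) \<Rightarrow> 'a"
  assumes r: "Well_order r"
    and inf: "\<And>\<alpha>. \<alpha> \<in> Field r \<Longrightarrow> infinite (N \<alpha>)"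
    and ad: "\<And>\<alpha> \<beta>. \<alpha> \<in> Field r \<Longrightarrow> \<beta> \<in> Field r \<Longrightarrow> \<alpha> \<noteq> \<beta> \<Longrightarrow> finite (N \<alpha> \<inter> N \<beta>)"
    and fin\<O>: "finite \<O>"
    and cont: "\<And>U x. U \<in> \<O> \<Longrightarrow> e x \<in> U \<Longrightarrow> \<exists>m. \<forall>y. (\<forall>k<m. y k = x k) \<longrightarrow> e y \<in> U"
    and "finite T" "T \<subseteq> Field r" "\<And>\<alpha> k. \<alpha> \<in> T \<Longrightarrow> k \<in> N \<alpha> \<Longrightarrow> \<not> x k"
  shows "\<exists>y. approximating_family r N e \<O> T x y"
  using assms(6-)
proof (induction T arbitrary: x rule: finite_psubset_induct)
  case (psubset T)
  show ?case
  proof (cases "T = {}")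
    case True
    then show ?thesis by (simp add: approximating_family_def)
  next
    case False
    have "wf (r - Id)" using r by (simp add: well_order_on_def)
    then obtain a where a: "a \<in> T" and min: "\<And>b. b \<in> T \<Longrightarrow> (b, a) \<in> r \<Longrightarrow> b = a"
      by (rule wfE_min'[OF _ False]) blast
    let ?T = "T - {a}"
    obtain m where
      m: "\<And>U y. U \<in> \<O> \<Longrightarrow> e x \<in> U \<Longrightarrow> \<forall>k<m. y k = x k \<Longrightarrow> e y \<in> U"
    proof -
      have "\<forall>U. \<exists>m. U \<in> \<O> \<longrightarrow> e x \<in> U \<longrightarrow> (\<forall>y. (\<forall>k<m. y k = x k) \<longrightarrow> e y \<in> U)"
        using cont[of _ x] by blast
      then obtain f where
        f: "\<forall>U. U \<in> \<O> \<longrightarrow> e x \<in> U \<longrightarrow> (\<forall>y. (\<forall>k<f U. y k = x k) \<longrightarrow> e y \<in> U)"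
        by (rule choice[THEN exE])
      \<comment> \<open>If \<open>\<O>\<close> is empty, the maximum is unspecified, but there is no
        \<open>U\<close> to check.\<close>
      show thesis
      proof (rule that)
        fix U y assume U: "U \<in> \<O>" "e x \<in> U" and y: "\<forall>k<Max (f ` \<O>). y k = x k"
        have "f U \<le> Max (f ` \<O>)" using U(1) fin\<O> by simp
        with y have "\<forall>k<f U. y k = x k" by simp
        with f U show "e y \<in> U" by simp
      qed
    qed
    \<comment> \<open>By almost disjointness only finitely many elements of \<open>N a\<close> lie
      below \<open>m\<close> or in another \<open>N b\<close>; any other one can serve as
      \<open>k\<close>.\<close>
    have "finite (\<Union>b\<in>?T. N a \<inter> N b)"
      by (rule finite_UN_I) (use psubset.prems a psubset.hyps in \<open>auto intro!: ad\<close>)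
    then have "finite ({..<m} \<union> (\<Union>b\<in>?T. N a \<inter> N b))" by blast
    then have "infinite (N a - ({..<m} \<union> (\<Union>b\<in>?T. N a \<inter> N b)))"
      using inf a psubset.prems by (intro Diff_infinite_finite) auto
    then obtain k where "k \<in> N a - ({..<m} \<union> (\<Union>b\<in>?T. N a \<inter> N b))"
      using infinite_imp_nonempty by (metis (no_types) ex_in_conv)
    then have k: "k \<in> N a" "m \<le> k" "\<And>b. b \<in> ?T \<Longrightarrow> k \<notin> N b"
      by auto
    let ?x = "x(k := True)"
    have near: "e ?x \<in> U" if "U \<in> \<O>" "e x \<in> U" for U
      using k(2) by (intro m[OF that]) simp
    have "\<exists>y. approximating_family r N e \<O> ?T ?x y"
    proof (rule psubset.IH)
      show "?T \<subset> T" using a by auto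
      show "?T \<subseteq> Field r" using psubset.prems by auto
      show "\<not> ?x j" if "\<alpha> \<in> ?T" "j \<in> N \<alpha>" for \<alpha> j
        using that psubset.prems k by auto
    qed
    then obtain y where af: "approximating_family r N e \<O> ?T ?x y" ..
    have y: "?x \<le> y \<beta> \<and> (\<forall>k\<in>N \<beta>. \<not> y \<beta> k) \<and>
        (\<forall>U\<in>\<O>. e ?x \<in> U \<longrightarrow> e (y \<beta>) \<in> U) \<and>
        (\<forall>\<alpha>\<in>?T. (\<alpha>, \<beta>) \<in> r \<and> \<alpha> \<noteq> \<beta> \<longrightarrow>
          (\<exists>k\<in>N \<alpha>. y \<beta> k) \<and> (\<forall>U\<in>\<O>. e (y \<alpha>) \<in> U \<longrightarrow> e (y \<beta>) \<in> U))" if "\<beta> \<in> ?T" for \<beta>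
      using af that unfolding approximating_family_def by (rule bspec)
    have xx: "x \<le> ?x" by (auto simp: le_fun_def)
    note yx = y[THEN conjunct1] and y0 = y[THEN conjunct2, THEN conjunct1]
      and y\<O> = y[THEN conjunct2, THEN conjunct2, THEN conjunct1]
    have later: "(\<exists>k\<in>N \<alpha>. y \<beta> k) \<and> (\<forall>U\<in>\<O>. e (y \<alpha>) \<in> U \<longrightarrow> e (y \<beta>) \<in> U)"
      if "\<alpha> \<in> ?T" "\<beta> \<in> ?T" "(\<alpha>, \<beta>) \<in> r" "\<alpha> \<noteq> \<beta>" for \<alpha> \<beta>
      using y[OF that(2)] that(1,3,4) by (elim conjE) (drule (1) bspec, simp)
    \<comment> \<open>The invariant \<open>?x \<le> y \<beta>\<close> keeps coordinate
      \<open>k\<close> switched on in all later points, which puts them outside the set belonging to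
      \<open>a\<close>.\<close>
    have yk: "y \<beta> k" if "\<beta> \<in> ?T" for \<beta>
      using le_funD[OF yx[OF that], of k] by simp
    have near': "e (y \<beta>) \<in> U" if "\<beta> \<in> ?T" "U \<in> \<O>" "e x \<in> U" for \<beta> U
      using y\<O>[OF that(1)] that(2) near[OF that(2,3)] by simp
    show ?thesis
    proof (intro exI[of _ "y(a := x)"], unfold approximating_family_def, intro ballI)
      fix \<beta> assume \<beta>: "\<beta> \<in> T"
      show "x \<le> (y(a := x)) \<beta> \<and> (\<forall>k\<in>N \<beta>. \<not> (y(a := x)) \<beta> k) \<and>
        (\<forall>U\<in>\<O>. e x \<in> U \<longrightarrow> e ((y(a := x)) \<beta>) \<in> U) \<and>
        (\<forall>\<alpha>\<in>T. (\<alpha>, \<beta>) \<in> r \<and> \<alpha> \<noteq> \<beta> \<longrightarrow>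
          (\<exists>k\<in>N \<alpha>. (y(a := x)) \<beta> k) \<and>
          (\<forall>U\<in>\<O>. e ((y(a := x)) \<alpha>) \<in> U \<longrightarrow> e ((y(a := x)) \<beta>) \<in> U))"
      proof (cases "\<beta> = a")
        case True
        have "\<forall>k\<in>N a. \<not> x k"
          using psubset.prems(2) a by blast
        \<comment> \<open>No other index of \<open>T\<close> precedes \<open>a\<close>, so the
          clause about earlier indices is vacuous.\<close>
        then show ?thesis using True by simp (metis min)
      next
        case False
        then have \<beta>': "\<beta> \<in> ?T" using \<beta> by auto
        have "(\<exists>k\<in>N \<alpha>. y \<beta> k) \<and> (\<forall>U\<in>\<O>. e ((y(a := x)) \<alpha>) \<in> U \<longrightarrow> e (y \<beta>) \<in> U)"
          if "\<alpha> \<in> T" "(\<alpha>, \<beta>) \<in> r" "\<alpha> \<noteq> \<beta>" for \<alpha>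
        proof (cases "\<alpha> = a")
          case True
          with k(1) yk[OF \<beta>'] near'[OF \<beta>'] show ?thesis by auto
        next
          case False
          with later[of \<alpha> \<beta>] \<beta>' that show ?thesis by simp
        qed
        moreover have "x \<le> y \<beta>" using xx yx[OF \<beta>'] by (rule order.trans)
        moreover have "\<forall>U\<in>\<O>. e x \<in> U \<longrightarrow> e (y \<beta>) \<in> U" using near'[OF \<beta>'] by simp
        ultimately show ?thesis using False y0[OF \<beta>'] by simp
      qed
    qed
  qed
qed

text \<open>Each condition involves two indices and one open set, so finitely many of them are met
  by a finite approximating family. The filter they generate is therefore proper and can be refined
  to an ultrafilter.\<close>

lemma ultrafilter_of_approximating_families:
  fixes r :: "'i rel" and N :: "'i \<Rightarrow> nat set" and e :: "(nat \<Rightarrow> bool) \<Rightarrow> 'a"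
  assumes r: "Well_order r"
    and inf: "\<And>\<alpha>. \<alpha> \<in> Field r \<Longrightarrow> infinite (N \<alpha>)"
    and ad: "\<And>\<alpha> \<beta>. \<alpha> \<in> Field r \<Longrightarrow> \<beta> \<in> Field r \<Longrightarrow> \<alpha> \<noteq> \<beta> \<Longrightarrow> finite (N \<alpha> \<inter> N \<beta>)"
    and cont: "\<And>U x. openin X U \<Longrightarrow> e x \<in> U \<Longrightarrow> \<exists>m. \<forall>y. (\<forall>k<m. y k = x k) \<longrightarrow> e y \<in> U"
    and Z: "\<And>\<alpha> x. \<alpha> \<in> Field r \<Longrightarrow> e x \<in> Z \<alpha> \<longleftrightarrow> (\<forall>k\<in>N \<alpha>. \<not> x k)"
  obtains W :: "('i \<Rightarrow> nat \<Rightarrow> bool) filter" where "W \<noteq> bot"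
    "\<And>P. eventually P W \<or> eventually (\<lambda>y. \<not> P y) W"
    "\<And>\<alpha>. \<alpha> \<in> Field r \<Longrightarrow> eventually (\<lambda>y. e (y \<alpha>) \<in> Z \<alpha>) W"
    "\<And>\<alpha> \<beta>. (\<alpha>, \<beta>) \<in> r \<Longrightarrow> \<alpha> \<noteq> \<beta> \<Longrightarrow> eventually (\<lambda>y. e (y \<beta>) \<notin> Z \<alpha>) W"
    "\<And>\<alpha> \<beta> U. (\<alpha>, \<beta>) \<in> r \<Longrightarrow> \<alpha> \<noteq> \<beta> \<Longrightarrow> openin X U \<Longrightarrow>
      eventually (\<lambda>y. e (y \<alpha>) \<in> U \<longrightarrow> e (y \<beta>) \<in> U) W"
proof -
  \<comment> \<open>For \<open>\<alpha> = \<beta>\<close> only membership in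
    \<open>Z \<alpha>\<close> is left. The diagonal triples, available because \<open>r\<close> is
    reflexive, thus cover every index, even a greatest one.\<close>
  define S where "S = (\<lambda>(\<alpha>, \<beta>, U). {y. e (y \<alpha>) \<in> Z \<alpha> \<and>
    (\<alpha> \<noteq> \<beta> \<longrightarrow> e (y \<beta>) \<notin> Z \<alpha> \<and> (e (y \<alpha>) \<in> U \<longrightarrow> e (y \<beta>) \<in> U))})"
  define J where "J = {(\<alpha>, \<beta>, U). (\<alpha>, \<beta>) \<in> r \<and> openin X U}"
  define F where "F = (INF j\<in>J. principal (S j))"
  have "F \<noteq> bot" unfolding F_def
  proof (rule INF_filter_not_bot)
    fix I assume I: "I \<subseteq> J" "finite I"
    define \<O> where "\<O> = (\<lambda>(\<alpha>, \<beta>, U). U) ` I"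
    define T where "T = (\<lambda>(\<alpha>, \<beta>, U). \<alpha>) ` I \<union> (\<lambda>(\<alpha>, \<beta>, U). \<beta>) ` I"
    have T: "finite T" "T \<subseteq> Field r" and \<O>: "finite \<O>" "\<And>U. U \<in> \<O> \<Longrightarrow> openin X U"
      using I by (auto simp: T_def \<O>_def J_def Field_def)
    \<comment> \<open>The zero sequence is a legitimate base point for any \<open>T\<close>, since
      it vanishes on every \<open>N \<alpha>\<close>.\<close>
    have "\<exists>y. approximating_family r N e \<O> T (\<lambda>_. False) y"
      using r inf ad \<O>(1) cont[OF \<O>(2)] T
      by (rule finite_approximating_family) auto
    then obtain y where af: "approximating_family r N e \<O> T (\<lambda>_. False) y" ..
    note af' = bspec[OF af[unfolded approximating_family_def]]
    have zero: "\<forall>k\<in>N \<beta>. \<not> y \<beta> k" if "\<beta> \<in> T" for \<beta>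
      using af'[OF that] by (elim conjE)
    have later: "(\<exists>k\<in>N \<alpha>. y \<beta> k) \<and> (\<forall>U\<in>\<O>. e (y \<alpha>) \<in> U \<longrightarrow> e (y \<beta>) \<in> U)"
      if "\<alpha> \<in> T" "\<beta> \<in> T" "(\<alpha>, \<beta>) \<in> r" "\<alpha> \<noteq> \<beta>" for \<alpha> \<beta>
      using af'[OF that(2)] that(1,3,4) by (elim conjE) (drule (1) bspec, simp)
    have "y \<in> S j" if j: "j \<in> I" for j
    proof -
      obtain \<alpha> \<beta> U where jj: "j = (\<alpha>, \<beta>, U)" by (cases j)
      have *: "\<alpha> \<in> T" "\<beta> \<in> T" "U \<in> \<O>" "(\<alpha>, \<beta>) \<in> r" "\<alpha> \<in> Field r"
        using j I unfolding jj by (force simp: T_def \<O>_def J_def Field_def)+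
      then show ?thesis using zero[of \<alpha>] later[of \<alpha> \<beta>] unfolding jj S_def by (simp add: Z)
    qed
    then have "y \<in> (\<Inter>j\<in>I. S j)" by blast
    moreover have "(INF j\<in>I. principal (S j)) = principal (\<Inter>j\<in>I. S j)"
      using I(2) by (rule INF_principal_finite)
    ultimately show "(INF j\<in>I. principal (S j)) \<noteq> bot"
      by (auto simp: principal_eq_bot_iff)
  qed
  then obtain W where W: "W \<le> F" "W \<noteq> bot"
    "\<And>P. eventually P W \<or> eventually (\<lambda>x. \<not> P x) W"
    by (rule ultrafilter_exists) blast
  have ev: "eventually (\<lambda>y. y \<in> S (\<alpha>, \<beta>, U)) W" if "(\<alpha>, \<beta>) \<in> r" "openin X U" for \<alpha> \<beta> U
  proof -
    have "eventually (\<lambda>y. y \<in> S (\<alpha>, \<beta>, U)) F"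
      unfolding F_def by (rule eventually_INF1[of "(\<alpha>, \<beta>, U)"])
        (use that in \<open>auto simp: J_def eventually_principal\<close>)
    then show ?thesis using W(1) by (rule filter_leD[rotated])
  qed
  show thesis
  proof (rule that[OF W(2,3)])
    fix \<alpha> assume "\<alpha> \<in> Field r"
    then have "(\<alpha>, \<alpha>) \<in> r"
      using r by (auto simp: order_on_defs refl_on_def)
    from ev[OF this openin_empty] show "eventually (\<lambda>y. e (y \<alpha>) \<in> Z \<alpha>) W"
      by eventually_elim (simp add: S_def)
  next
    fix \<alpha> \<beta> assume "(\<alpha>, \<beta>) \<in> r" "\<alpha> \<noteq> \<beta>"
    with ev[OF this(1) openin_empty] show "eventually (\<lambda>y. e (y \<beta>) \<notin> Z \<alpha>) W"
      by (auto simp: S_def elim: eventually_mono)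
  next
    fix \<alpha> \<beta> U assume "(\<alpha>, \<beta>) \<in> r" "\<alpha> \<noteq> \<beta>" "openin X U"
    with ev[of \<alpha> \<beta> U] show "eventually (\<lambda>y. e (y \<alpha>) \<in> U \<longrightarrow> e (y \<beta>) \<in> U) W"
      by (auto simp: S_def elim: eventually_mono)
  qed
qed

subsection \<open>Cantor sets in uncountable Polish spaces\<close>

context Metric_space
begin

definition condensation_points :: "'a set \<Rightarrow> 'a set" where
  "condensation_points S = {x \<in> S. \<forall>r>0. uncountable (mball x r \<inter> S)}"

text \<open>A Cantor-Bendixson argument: each exceptional point lies in a ball with rational radius
  and center in a countable dense set that meets \<open>S\<close> in a countable set, and there are
  only countably many such balls.\<close>

lemma countable_noncondensation_points:
  assumes "separable_space mtopology" "S \<subseteq> M"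
  shows "countable (S - condensation_points S)"
proof -
  obtain C where C: "countable C" "C \<subseteq> M" "mtopology closure_of C = M"
    using assms(1) by (auto simp: separable_space_def)
  let ?I = "{(c, q). c \<in> C \<and> q \<in> \<rat> \<and> countable (mball c q \<inter> S)}"
  have "S - condensation_points S \<subseteq> (\<Union>(c, q)\<in>?I. mball c q \<inter> S)"
  proof
    fix x assume x: "x \<in> S - condensation_points S"
    then obtain r where r: "r > 0" "countable (mball x r \<inter> S)" and "x \<in> M"
      using assms(2) by (auto simp: condensation_points_def)
    \<comment> \<open>Half of \<open>r\<close> is taken so that a ball of radius \<open>q\<close>
      about a center within \<open>q\<close> of \<open>x\<close> stays inside
      \<open>mball x r\<close>.\<close>
    obtain q where q: "q \<in> \<rat>" "0 < q" "q < r / 2"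
      using Rats_dense_in_real[of 0 "r / 2"] r by auto
    have "x \<in> mtopology closure_of C" using C \<open>x \<in> M\<close> by simp
    then obtain c where c: "c \<in> C" "d x c < q"
      using q by (auto simp: metric_closure_of)
    have "mball c q \<subseteq> mball x r"
      using c q \<open>x \<in> M\<close> C by (intro mball_subset) (auto simp: commute)
    then have "countable (mball c q \<inter> S)"
      using r(2) by (meson Int_mono countable_subset order_refl)
    moreover have "x \<in> mball c q \<inter> S"
      using c C \<open>x \<in> M\<close> x by (auto simp: commute)
    ultimately show "x \<in> (\<Union>(c, q)\<in>?I. mball c q \<inter> S)"
      using c q by blast
  qed
  moreover have "countable ?I"
    by (rule countable_subset[of _ "C \<times> \<rat>"]) (use C countable_rat in auto)
  then have "countable (\<Union>(c, q)\<in>?I. mball c q \<inter> S)"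
    by (rule countable_UN) auto
  ultimately show ?thesis by (rule countable_subset)
qed

lemma uncountable_condensation_points:
  assumes "separable_space mtopology" "S \<subseteq> M" "uncountable S"
  shows "uncountable (condensation_points S)"
proof
  assume "countable (condensation_points S)"
  with countable_noncondensation_points[OF assms(1,2)] assms(3) show False
    using uncountable_minus_countable by blast
qed

text \<open>The branching step of the Cantor scheme. The centers are two distinct condensation
  points of the ball, so that arbitrarily small balls about them are still uncountable.\<close>

lemma uncountable_mball_split:
  assumes sep: "separable_space mtopology" and unc: "uncountable (mball x r)"
  obtains x0 x1 s where "0 < s" "s \<le> r / 2" "uncountable (mball x0 s)" "uncountable (mball x1 s)"
    "mcball x0 s \<subseteq> mball x r" "mcball x1 s \<subseteq> mball x r" "mcball x0 s \<inter> mcball x1 s = {}"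
proof -
  let ?C = "condensation_points (mball x r)"
  have uncC: "uncountable ?C"
    using sep unc by (intro uncountable_condensation_points) auto
  then obtain x0 where x0: "x0 \<in> ?C" by (metis countable_empty ex_in_conv)
  have "uncountable (?C - {x0})" using uncC by (simp add: uncountable_minus_countable)
  then obtain x1 where x1: "x1 \<in> ?C" "x1 \<noteq> x0" by (metis DiffE countable_empty ex_in_conv insertI1)
  have in_ball: "x0 \<in> mball x r" "x1 \<in> mball x r"
    using x0 x1 by (auto simp: condensation_points_def)
  then have M: "x \<in> M" "x0 \<in> M" "x1 \<in> M" and lt: "d x x0 < r" "d x x1 < r" by auto
  have pos: "0 < d x0 x1" using M x1 by auto
  \<comment> \<open>The first bound halves the radius, the next two keep the closed balls inside
    \<open>mball x r\<close>, and the last makes them disjoint, as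
    \<open>s + s < d x0 x1\<close>.\<close>
  define s where "s = min (r / 2) (min ((r - d x x0) / 2) (min ((r - d x x1) / 2) (d x0 x1 / 3)))"
  have "r > 0" using lt M nonneg[of x x0] by linarith
  have s: "0 < s" "s \<le> r / 2" "s \<le> (r - d x x0) / 2" "s \<le> (r - d x x1) / 2" "s \<le> d x0 x1 / 3"
    using lt pos \<open>r > 0\<close> by (simp_all add: s_def min_def)
  have unc_s: "uncountable (mball z s)" if "z \<in> ?C" for z
  proof -
    have "uncountable (mball z s \<inter> mball x r)"
      using that s by (auto simp: condensation_points_def)
    then show ?thesis by (meson countable_subset inf_le1)
  qed
  show thesis
  proof (rule that[OF s(1,2) unc_s[OF x0] unc_s[OF x1(1)]])
    show "mcball x0 s \<subseteq> mball x r"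
      by (rule mcball_subset_mball) (use M s lt in \<open>auto simp: commute\<close>)
    show "mcball x1 s \<subseteq> mball x r"
      by (rule mcball_subset_mball) (use M s lt in \<open>auto simp: commute\<close>)
    show "mcball x0 s \<inter> mcball x1 s = {}"
    proof (rule equals0I)
      fix z assume "z \<in> mcball x0 s \<inter> mcball x1 s"
      then have "d x0 x1 \<le> s + s" using triangle[of x0 z x1] by (auto simp: commute)
      with s pos show False by linarith
    qed
  qed
qed

text \<open>\<open>e x\<close> is a point common to the closed balls along the branch
  \<open>x\<close> of a binary tree of balls; completeness provides it. The last two conclusions
  express in coordinates that \<open>e\<close> is continuous and that its inverse is continuous on
  the image.\<close>

lemma Cantor_scheme:
  assumes sep: "separable_space mtopology" and mcomplete
    and unc: "uncountable (mball p r)"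
  obtains e :: "(nat \<Rightarrow> bool) \<Rightarrow> 'a" where
    "range e \<subseteq> mcball p r"
    "\<And>U x. openin mtopology U \<Longrightarrow> e x \<in> U \<Longrightarrow> \<exists>m. \<forall>y. (\<forall>k<m. y k = x k) \<longrightarrow> e y \<in> U"
    "\<And>x m. \<exists>U. openin mtopology U \<and> e x \<in> U \<and> (\<forall>y. e y \<in> U \<longrightarrow> (\<forall>k<m. y k = x k))"
proof -
  \<comment> \<open>A pair \<open>q\<close> encodes a ball by center and radius. The implication
    makes the choice of the two children total in \<open>q\<close>.\<close>
  have "\<exists>c. uncountable (mball (fst q) (snd q)) \<longrightarrow>
      (\<forall>b::bool. snd (c b) \<le> snd q / 2 \<and> uncountable (mball (fst (c b)) (snd (c b))) \<and>
        mcball (fst (c b)) (snd (c b)) \<subseteq> mball (fst q) (snd q)) \<and>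
      mcball (fst (c True)) (snd (c True)) \<inter> mcball (fst (c False)) (snd (c False)) = {}"
    for q
  proof (cases "uncountable (mball (fst q) (snd q))")
    case True
    from uncountable_mball_split[OF sep True] obtain x0 x1 s where
      "0 < s" "s \<le> snd q / 2" "uncountable (mball x0 s)" "uncountable (mball x1 s)"
      "mcball x0 s \<subseteq> mball (fst q) (snd q)" "mcball x1 s \<subseteq> mball (fst q) (snd q)"
      "mcball x0 s \<inter> mcball x1 s = {}" .
    then show ?thesis
      by (intro exI[of _ "\<lambda>b. if b then (x0, s) else (x1, s)"]) simp
  qed simp
  then obtain c where c: "\<And>q. uncountable (mball (fst q) (snd q)) \<Longrightarrow>
      (\<forall>b::bool. snd (c q b) \<le> snd q / 2 \<and> uncountable (mball (fst (c q b)) (snd (c q b))) \<and>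
        mcball (fst (c q b)) (snd (c q b)) \<subseteq> mball (fst q) (snd q)) \<and>
      mcball (fst (c q True)) (snd (c q True)) \<inter> mcball (fst (c q False)) (snd (c q False)) = {}"
    by metis
  define node :: "(nat \<Rightarrow> bool) \<Rightarrow> nat \<Rightarrow> 'a \<times> real"
    where "node x = rec_nat (p, r) (\<lambda>n q. c q (x n))" for x
  have node_0: "node x 0 = (p, r)" and node_Suc: "node x (Suc n) = c (node x n) (x n)" for x n
    by (simp_all add: node_def)
  define B where "B x n = mball (fst (node x n)) (snd (node x n))" for x n
  define C where "C x n = mcball (fst (node x n)) (snd (node x n))" for x n
  have unc_B: "uncountable (B x n)" for x n
  proof (induction n)
    case 0
    then show ?case using unc by (simp add: B_def node_0)
  next
    case (Suc n)
    then show ?case using c[of "node x n"] by (simp add: B_def node_Suc)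
  qed
  note step = c[OF unc_B[unfolded B_def]]
  \<comment> \<open>Closed balls sit inside the open ball of the parent, so \<open>e x\<close> lies
    in every open ball of its branch; these balls are the neighborhoods required at the end.\<close>
  have C_sub_B: "C x (Suc n) \<subseteq> B x n" for x n
    using step[of x n] by (simp add: B_def C_def node_Suc)
  have B_sub_C: "B x n \<subseteq> C x n" for x n
    by (auto simp: B_def C_def)
  have radius: "snd (node x n) \<le> r / 2 ^ n" for x n
  proof (induction n)
    case (Suc n)
    have "snd (node x (Suc n)) \<le> snd (node x n) / 2"
      using step[of x n] by (simp add: node_Suc)
    also have "\<dots> \<le> r / 2 ^ n / 2"
      using Suc.IH by simp
    finally show ?case by (simp add: field_simps)
  qed (simp add: node_0)
  have dec: "decseq (C x)" for x
    using C_sub_B B_sub_C by (intro decseq_SucI) (meson order.trans)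
  have "0 < r"
    using unc by (metis countable_empty mball_eq_empty not_less)
  have small: "\<exists>n. snd (node x n) < \<epsilon>" if "\<epsilon> > 0" for \<epsilon> x
  proof -
    obtain n where "r / \<epsilon> < 2 ^ n"
      using real_arch_pow[of 2 "r / \<epsilon>"] by auto
    then have "r / 2 ^ n < \<epsilon>" using that by (simp add: field_simps)
    then show ?thesis using radius[of x n] by (meson order.strict_trans1)
  qed
  have "\<exists>l. l \<in> (\<Inter>n. C x n)" for x
  proof -
    have "\<forall>n. closedin mtopology (C x n)" by (simp add: C_def)
    moreover have "\<forall>n. C x n \<noteq> {}"
      using unc_B B_sub_C by (metis countable_empty subset_empty)
    moreover have "\<forall>\<epsilon>>0. \<exists>n a. C x n \<subseteq> mcball a \<epsilon>"
      using small[of _ x] unfolding C_def by (meson less_imp_le mcball_subset_concentric)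
    ultimately have "\<Inter> (range (C x)) \<noteq> {}"
      using \<open>mcomplete\<close> dec[of x] unfolding mcomplete_nest by blast
    then show ?thesis by blast
  qed
  then obtain e where e: "\<And>x. e x \<in> (\<Inter>n. C x n)" by metis
  then have eC: "e x \<in> C x n" for x n by blast
  then have eB: "e x \<in> B x n" for x n using C_sub_B by blast
  have node_cong: "node y n = node x n" if "\<forall>k<n. y k = x k" for x y n
    using that by (induction n) (auto simp: node_0 node_Suc)
  \<comment> \<open>At the first disagreement \<open>e y\<close> would lie in two disjoint sibling
    balls.\<close>
  have agree: "\<forall>k<n. y k = x k" if "e y \<in> C x n" for x y n
    using that
  proof (induction n)
    case (Suc n)
    have "e y \<in> C x n" using Suc.prems C_sub_B B_sub_C by blast
    then have IH: "\<forall>k<n. y k = x k" by (rule Suc.IH)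
    have "y n = x n"
    proof (rule ccontr)
      assume ne: "y n \<noteq> x n"
      have "e y \<in> mcball (fst (c (node x n) (y n))) (snd (c (node x n) (y n)))"
        using eC[of y "Suc n"] node_cong[OF IH] by (simp add: C_def node_Suc)
      moreover have "e y \<in> mcball (fst (c (node x n) (x n))) (snd (c (node x n) (x n)))"
        using Suc.prems by (simp add: C_def node_Suc)
      ultimately have "e y \<in> mcball (fst (c (node x n) True)) (snd (c (node x n) True)) \<inter>
          mcball (fst (c (node x n) False)) (snd (c (node x n) False))"
        using ne by (cases "x n"; cases "y n") simp_all
      with step[of x n] show False by blast
    qed
    with IH show ?case by (auto simp: less_Suc_eq)
  qed simp
  show thesis
  proof (rule that)
    show "range e \<subseteq> mcball p r"
      using eC[of _ 0] by (auto simp: C_def node_0)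
  next
    fix U x assume U: "openin mtopology U" "e x \<in> U"
    then obtain \<epsilon> where \<epsilon>: "\<epsilon> > 0" "mball (e x) \<epsilon> \<subseteq> U"
      by (auto simp: openin_mtopology)
    \<comment> \<open>Two points of a closed ball of radius less than \<open>\<epsilon> / 2\<close>
      are less than \<open>\<epsilon>\<close> apart.\<close>
    obtain n where n: "snd (node x n) < \<epsilon> / 2" using small[of "\<epsilon> / 2" x] \<epsilon> by auto
    have "e y \<in> U" if "\<forall>k<n. y k = x k" for y
    proof -
      have "e y \<in> C x n" using eC[of y n] node_cong[OF that] by (simp add: C_def)
      then have "e y \<in> mball (e x) \<epsilon>"
        using eC[of x n] n triangle[of "e x" "fst (node x n)" "e y"] by (auto simp: C_def commute)
      with \<epsilon> show ?thesis by blast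
    qed
    then show "\<exists>m. \<forall>y. (\<forall>k<m. y k = x k) \<longrightarrow> e y \<in> U" by blast
  next
    fix x m
    show "\<exists>U. openin mtopology U \<and> e x \<in> U \<and> (\<forall>y. e y \<in> U \<longrightarrow> (\<forall>k<m. y k = x k))"
    proof (intro exI[of _ "B x m"] conjI allI impI)
      show "openin mtopology (B x m)" by (simp add: B_def)
      show "e x \<in> B x m" by (rule eB)
      show "y k = x k" if "e y \<in> B x m" "k < m" for y k
        using agree[of y x m] that B_sub_C by blast
    qed
  qed
qed

end

lemma Cantor_embedding:
  assumes "polish_topology X" "openin X V" "uncountable V"
  obtains e :: "(nat \<Rightarrow> bool) \<Rightarrow> 'a" where
    "range e \<subseteq> V"
    "\<And>U x. openin X U \<Longrightarrow> e x \<in> U \<Longrightarrow> \<exists>m. \<forall>y. (\<forall>k<m. y k = x k) \<longrightarrow> e y \<in> U"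
    "\<And>x m. \<exists>U. openin X U \<and> e x \<in> U \<and> (\<forall>y. e y \<in> U \<longrightarrow> (\<forall>k<m. y k = x k))"
proof -
  obtain M d where M: "Metric_space M d" and X: "X = Metric_space.mtopology M d"
    and complete: "Metric_space.mcomplete M d"
    using assms(1) by (auto simp: polish_topology_def completely_metrizable_space_def)
  interpret Metric_space M d by fact
  have sep: "separable_space mtopology"
    using assms(1) X by (simp add: polish_topology_def)
  have V: "V \<subseteq> M" using assms(2) X openin_subset by fastforce
  \<comment> \<open>Around a condensation point of \<open>V\<close>, a ball small enough to fit into
    \<open>V\<close> is still uncountable, as the scheme requires.\<close>
  obtain p where p: "p \<in> condensation_points V"
    using uncountable_condensation_points[OF sep V assms(3)] by (metis countable_empty ex_in_conv)
  then have "p \<in> V" by (simp add: condensation_points_def)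
  then obtain r where r: "r > 0" "mcball p r \<subseteq> V"
    using assms(2) X by (auto simp: openin_mtopology_mcball)
  have "uncountable (mball p r \<inter> V)" using p r by (simp add: condensation_points_def)
  then have "uncountable (mball p r)" by (meson countable_subset inf_le1)
  from Cantor_scheme[OF sep complete this] obtain e :: "(nat \<Rightarrow> bool) \<Rightarrow> 'a" where
    "range e \<subseteq> mcball p r"
    "\<And>U x. openin mtopology U \<Longrightarrow> e x \<in> U \<Longrightarrow> \<exists>m. \<forall>y. (\<forall>k<m. y k = x k) \<longrightarrow> e y \<in> U"
    "\<And>x m. \<exists>U. openin mtopology U \<and> e x \<in> U \<and> (\<forall>y. e y \<in> U \<longrightarrow> (\<forall>k<m. y k = x k))"
    by blast
  with r(2) show thesis unfolding X[symmetric] by (intro that) auto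
qed

text \<open>Every neighborhood of a condensation point of the space is uncountable, and local
  compactness places one inside a compact set.\<close>

lemma uncountable_open_in_compact:
  assumes "polish_topology X" "locally_compact_space X" "uncountable (topspace X)"
  obtains V K where "openin X V" "uncountable V" "compactin X K" "V \<subseteq> K"
proof -
  obtain M d where M: "Metric_space M d" and X: "X = Metric_space.mtopology M d"
    using assms(1) by (auto simp: polish_topology_def completely_metrizable_space_def)
  interpret Metric_space M d by fact
  have sep: "separable_space mtopology"
    using assms(1) X by (simp add: polish_topology_def)
  have "uncountable M" using assms(3) X by simp
  then obtain p where p: "p \<in> condensation_points M"
    using uncountable_condensation_points[OF sep] by (metis countable_empty ex_in_conv order_refl)
  then have "p \<in> M" by (simp add: condensation_points_def)
  then obtain V K where VK: "openin X V" "compactin X K" "p \<in> V" "V \<subseteq> K"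
    using assms(2) X by (auto simp: locally_compact_space_def)
  then obtain r where "r > 0" "mball p r \<subseteq> V"
    using X by (auto simp: openin_mtopology)
  moreover from this p have "uncountable (mball p r \<inter> M)" by (simp add: condensation_points_def)
  ultimately have "uncountable V" by (meson countable_subset inf_le1 order.trans)
  with VK that show thesis by blast
qed

subsection \<open>Zero sets and ideals of continuous functions\<close>

lemma closedin_zero_set:
  fixes f :: "'a \<Rightarrow> 'k::real_normed_field"
  assumes "f \<in> cont_functions X"
  shows "closedin X (zero_set X f)"
proof -
  have "closedin X {x \<in> topspace X. f x \<in> {0}}"
    using assms by (intro closedin_continuous_map_preimage) (auto simp: cont_functions_def)
  then show ?thesis by (simp add: zero_set_def)
qed

text \<open>The distance to \<open>C\<close> vanishes exactly on the closure of \<open>C\<close> and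
  is 1-Lipschitz. The empty set, whose infimum would be unspecified, gets the constant 1.\<close>

lemma (in Metric_space) closed_eq_zero_set_real:
  assumes C: "closedin mtopology C"
  obtains h where "continuous_map mtopology euclideanreal h" "{x \<in> M. h x = 0} = C"
proof (cases "C = {}")
  case True
  show ?thesis by (rule that[of "\<lambda>_. 1"]) (use True in auto)
next
  case False
  have CM: "C \<subseteq> M" using C closedin_subset by fastforce
  define h where "h x = (INF c\<in>C. d x c)" for x
  have bdd: "bdd_below (d x ` C)" for x
    by (rule bdd_belowI[of _ 0]) auto
  have lip: "h x \<le> h y + d x y" if "x \<in> M" "y \<in> M" for x y
  proof -
    have "h x - d x y \<le> d y c" if "c \<in> C" for c
    proof -
      have "h x \<le> d x c" unfolding h_def using bdd that by (rule cINF_lower)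
      also have "\<dots> \<le> d x y + d y c"
        using \<open>x \<in> M\<close> \<open>y \<in> M\<close> that CM by (intro triangle) auto
      finally show ?thesis by simp
    qed
    then have "h x - d x y \<le> h y" unfolding h_def[of y] using False by (intro cINF_greatest) auto
    then show ?thesis by simp
  qed
  have cont: "continuous_map mtopology euclideanreal h"
    unfolding mtopology_is_euclidean[symmetric] Metric_space.metric_continuous_map[OF Metric_space_axioms Met_TC.Metric_space_axioms]
  proof (intro conjI ballI allI impI)
    fix a and \<epsilon> :: real assume a: "a \<in> M" "\<epsilon> > 0"
    have "dist (h a) (h x) < \<epsilon>" if "x \<in> M" "d a x < \<epsilon>" for x
      using lip[of a x] lip[of x a] that a commute[of a x] by (simp add: dist_real_def)
    with a show "\<exists>\<delta>>0. \<forall>x. x \<in> M \<and> d a x < \<delta> \<longrightarrow> dist (h a) (h x) < \<epsilon>" by blast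
  qed auto
  have "h x = 0 \<longleftrightarrow> x \<in> C" if x: "x \<in> M" for x
  proof
    assume "x \<in> C"
    then have "h x \<le> 0" using cINF_lower[OF bdd \<open>x \<in> C\<close>, of x] x by (simp add: h_def)
    moreover have "0 \<le> h x" unfolding h_def using False by (intro cINF_greatest) auto
    ultimately show "h x = 0" by simp
  next
    assume h0: "h x = 0"
    have "x \<in> mtopology closure_of C"
      unfolding metric_closure_of
    proof (intro CollectI conjI allI impI x)
      fix r :: real assume "r > 0"
      then have "(INF c\<in>C. d x c) < r" using h0 by (simp add: h_def)
      then obtain c where "c \<in> C" "d x c < r"
        using False by (meson cINF_less_iff bdd)
      then show "\<exists>y\<in>C. y \<in> mball x r" using x CM by auto
    qed
    then show "x \<in> C" using C by (simp add: closure_of_closedin)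
  qed
  then have "{x \<in> M. h x = 0} = C" using CM by auto
  with cont that show ?thesis by blast
qed

lemma closedin_eq_zero_set:
  assumes "metrizable_space X" "closedin X C"
  obtains f :: "'a \<Rightarrow> 'k::real_normed_field" where "f \<in> cont_functions X" "zero_set X f = C"
proof -
  obtain M d where "Metric_space M d" and X: "X = Metric_space.mtopology M d"
    using assms(1) by (auto simp: metrizable_space_def)
  interpret Metric_space M d by fact
  obtain h where h: "continuous_map mtopology euclideanreal h" "{x \<in> M. h x = 0} = C"
    using assms(2) X closed_eq_zero_set_real by blast
  let ?f = "\<lambda>x\<in>topspace X. (of_real (h x) :: 'k)"
  have "continuous_map X euclidean (\<lambda>x. of_real (h x) :: 'k)"
    using h(1) unfolding X by (simp add: continuous_map_atin tendsto_of_real)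
  then have "continuous_map X euclidean ?f"
    by (rule continuous_map_eq) auto
  then have "?f \<in> cont_functions X"
    by (simp add: cont_functions_def)
  moreover have "zero_set X ?f = C"
    using h(2) by (auto simp: zero_set_def X)
  ultimately show thesis by (rule that)
qed

text \<open>Consequently the notion of \<open>z\<close>-filter is the same for every scalar field,
  and only closed sets have to be handled.\<close>

lemma zero_sets_eq_closed:
  assumes "metrizable_space X"
  shows "zero_sets TYPE('k::real_normed_field) X = {C. closedin X C}"
proof
  show "zero_sets TYPE('k) X \<subseteq> {C. closedin X C}"
    using closedin_zero_set by (auto simp: zero_sets_def)
  show "{C. closedin X C} \<subseteq> zero_sets TYPE('k) X"
  proof
    fix C assume "C \<in> {C. closedin X C}"
    then obtain f :: "'a \<Rightarrow> 'k" where "f \<in> cont_functions X" "zero_set X f = C"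
      using closedin_eq_zero_set[OF assms] by auto
    then show "C \<in> zero_sets TYPE('k) X" by (auto simp: zero_sets_def)
  qed
qed

section \<open>The algebra of functions vanishing at infinity\<close>

lemma C0_functionsI:
  assumes "continuous_map X euclidean f"
    and "\<And>\<epsilon>. \<epsilon> > 0 \<Longrightarrow> \<exists>K. compactin X K \<and> (\<forall>x \<in> topspace X - K. norm (f x) < \<epsilon>)"
  shows "(\<lambda>x\<in>topspace X. f x) \<in> C0_functions X"
proof -
  have "continuous_map X euclidean (\<lambda>x\<in>topspace X. f x)"
    using assms(1) by (rule continuous_map_eq) auto
  then show ?thesis using assms(2) by (simp add: C0_functions_def cont_functions_def)
qed

lemma C0_functionsD:
  assumes "f \<in> C0_functions X"
  shows "f \<in> cont_functions X" "continuous_map X euclidean f"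
    "\<epsilon> > 0 \<Longrightarrow> \<exists>K. compactin X K \<and> (\<forall>x \<in> topspace X - K. norm (f x) < \<epsilon>)"
  using assms by (auto simp: C0_functions_def cont_functions_def)

lemma C0_functions_zero: "(\<lambda>x\<in>topspace X. 0) \<in> C0_functions X"
  by (rule C0_functionsI) (auto intro!: exI[of _ "{}"])

lemma C0_functions_add:
  assumes f: "f \<in> C0_functions X" and g: "g \<in> C0_functions X"
  shows "(\<lambda>x\<in>topspace X. f x + g x) \<in> C0_functions X"
proof (rule C0_functionsI)
  show "continuous_map X euclidean (\<lambda>x. f x + g x)"
    using f g by (intro continuous_map_add C0_functionsD)
  fix \<epsilon> :: real assume "\<epsilon> > 0"
  then obtain K L where K: "compactin X K" "\<And>x. x \<in> topspace X - K \<Longrightarrow> norm (f x) < \<epsilon> / 2"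
    and L: "compactin X L" "\<And>x. x \<in> topspace X - L \<Longrightarrow> norm (g x) < \<epsilon> / 2"
    using C0_functionsD(3)[OF f, of "\<epsilon> / 2"] C0_functionsD(3)[OF g, of "\<epsilon> / 2"] by auto
  have "norm (f x + g x) < \<epsilon>" if "x \<in> topspace X - (K \<union> L)" for x
    using that K(2)[of x] L(2)[of x] norm_triangle_ineq[of "f x" "g x"] by auto
  with K(1) L(1) show "\<exists>K. compactin X K \<and> (\<forall>x \<in> topspace X - K. norm (f x + g x) < \<epsilon>)"
    by (meson compactin_Un)
qed

lemma C0_functions_mult:
  assumes f: "f \<in> C0_functions X" and g: "g \<in> C0_functions X"
  shows "(\<lambda>x\<in>topspace X. f x * g x) \<in> C0_functions X"
proof (rule C0_functionsI)
  show "continuous_map X euclidean (\<lambda>x. f x * g x)"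
    using C0_functionsD(2)[OF f] C0_functionsD(2)[OF g]
    by (simp add: continuous_map_atin tendsto_mult)
  fix \<epsilon> :: real assume "\<epsilon> > 0"
  then obtain K L where K: "compactin X K" "\<And>x. x \<in> topspace X - K \<Longrightarrow> norm (f x) < 1"
    and L: "compactin X L" "\<And>x. x \<in> topspace X - L \<Longrightarrow> norm (g x) < \<epsilon>"
    using C0_functionsD(3)[OF f, of 1] C0_functionsD(3)[OF g, of \<epsilon>] by auto
  have "norm (f x * g x) < \<epsilon>" if "x \<in> topspace X - (K \<union> L)" for x
    using that K(2)[of x] L(2)[of x] mult_strict_mono'[of "norm (f x)" 1 "norm (g x)" \<epsilon>]
    by (simp add: norm_mult)
  with K(1) L(1) show "\<exists>K. compactin X K \<and> (\<forall>x \<in> topspace X - K. norm (f x * g x) < \<epsilon>)"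
    by (meson compactin_Un)
qed

lemma C0_functions_scale:
  assumes f: "f \<in> C0_functions X"
  shows "(\<lambda>x\<in>topspace X. c * f x) \<in> C0_functions X"
proof (rule C0_functionsI)
  show "continuous_map X euclidean (\<lambda>x. c * f x)"
    using C0_functionsD(2)[OF f] by (simp add: continuous_map_atin tendsto_mult)
  fix \<epsilon> :: real assume \<epsilon>: "\<epsilon> > 0"
  \<comment> \<open>Adding 1 keeps the divisor positive when \<open>c = 0\<close>.\<close>
  have "0 < norm c + 1" by (simp add: add_nonneg_pos)
  with \<epsilon> obtain K where K: "compactin X K"
    "\<And>x. x \<in> topspace X - K \<Longrightarrow> norm (f x) < \<epsilon> / (norm c + 1)"
    using C0_functionsD(3)[OF f, of "\<epsilon> / (norm c + 1)"] by auto
  have "norm (c * f x) < \<epsilon>" if "x \<in> topspace X - K" for x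
  proof -
    have "norm (c * f x) \<le> (norm c + 1) * norm (f x)"
      by (simp add: norm_mult mult_right_mono)
    also have "\<dots> < \<epsilon>"
      using K(2)[OF that] \<open>0 < norm c + 1\<close> by (simp add: pos_less_divide_eq mult.commute)
    finally show ?thesis .
  qed
  with K(1) show "\<exists>K. compactin X K \<and> (\<forall>x \<in> topspace X - K. norm (c * f x) < \<epsilon>)" by blast
qed

text \<open>A continuous function with zero set \<open>C\<close> vanishes off the compact set
  \<open>K\<close>, hence at infinity.\<close>

lemma C0_function_with_zero_set:
  assumes "metrizable_space X" "closedin X C" "compactin X K" "topspace X - K \<subseteq> C"
  obtains f :: "'a \<Rightarrow> 'k::real_normed_field" where "f \<in> C0_functions X" "zero_set X f = C"
proof -
  obtain f :: "'a \<Rightarrow> 'k" where f: "f \<in> cont_functions X" "zero_set X f = C"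
    using closedin_eq_zero_set[OF assms(1,2)] .
  have "norm (f x) < \<epsilon>" if "\<epsilon> > 0" "x \<in> topspace X - K" for x \<epsilon>
  proof -
    have "x \<in> zero_set X f" using that assms(4) f(2) by blast
    with that show ?thesis by (simp add: zero_set_def)
  qed
  with f(1) assms(3) have "f \<in> C0_functions X" by (auto simp: C0_functions_def)
  with f(2) that show thesis by blast
qed

section \<open>Ideals arising from \<open>z\<close>-filters\<close>

lemma z_filterD:
  assumes "z_filter k X F"
  shows "F \<noteq> {}" "\<And>Z. Z \<in> F \<Longrightarrow> Z \<in> zero_sets k X"
    "\<And>Z Z'. Z \<in> F \<Longrightarrow> Z' \<in> F \<Longrightarrow> Z \<inter> Z' \<in> F"
    "\<And>Z Z'. Z \<in> F \<Longrightarrow> Z' \<in> zero_sets k X \<Longrightarrow> Z \<subseteq> Z' \<Longrightarrow> Z' \<in> F"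
  using assms by (auto simp: z_filter_def)

lemma zero_set_in_zero_sets:
  fixes f :: "'a \<Rightarrow> 'k::real_normed_field"
  shows "f \<in> C0_functions X \<Longrightarrow> zero_set X f \<in> zero_sets TYPE('k) X"
  by (auto simp: zero_sets_def C0_functions_def)

lemma C0_z_ideal_z_inverse:
  assumes F: "z_filter TYPE('k::real_normed_field) X F"
  shows "C0_z_ideal X (C0_functions X \<inter> (z_inverse X F :: ('a \<Rightarrow> 'k) set))"
proof -
  let ?I = "C0_functions X \<inter> (z_inverse X F :: ('a \<Rightarrow> 'k) set)"
  have mem: "f \<in> ?I \<longleftrightarrow> f \<in> C0_functions X \<and> zero_set X f \<in> F" for f
    by (auto simp: z_inverse_def C0_functions_def)
  \<comment> \<open>All closure properties reduce to this: the zero set of a sum, multiple or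
    product contains a member of \<open>F\<close>.\<close>
  have up: "f \<in> ?I" if "f \<in> C0_functions X" "Z \<in> F" "Z \<subseteq> zero_set X f" for f Z
    using that z_filterD(4)[OF F] zero_set_in_zero_sets mem by blast
  have "C0_ideal X ?I"
    unfolding C0_ideal_def
  proof (intro conjI ballI allI)
    obtain Z where "Z \<in> F" using z_filterD(1)[OF F] by blast
    moreover from this have "Z \<subseteq> topspace X"
      using z_filterD(2)[OF F] by (auto simp: zero_sets_def zero_set_def)
    ultimately show "(\<lambda>x\<in>topspace X. 0) \<in> ?I"
      by (intro up[of _ Z] C0_functions_zero) (auto simp: zero_set_def)
  next
    fix f g assume f: "f \<in> ?I" and g: "g \<in> ?I"
    show "(\<lambda>x\<in>topspace X. f x + g x) \<in> ?I"
      using f g mem z_filterD(3)[OF F]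
      by (intro up[of _ "zero_set X f \<inter> zero_set X g"] C0_functions_add) (auto simp: zero_set_def)
  next
    fix c f assume f: "f \<in> ?I"
    then show "(\<lambda>x\<in>topspace X. c * f x) \<in> ?I"
      using mem by (intro up[of _ "zero_set X f"] C0_functions_scale) (auto simp: zero_set_def)
  next
    fix g f :: "'a \<Rightarrow> 'k" assume "g \<in> C0_functions X" "f \<in> ?I"
    then show "(\<lambda>x\<in>topspace X. g x * f x) \<in> ?I"
      using mem by (intro up[of _ "zero_set X f"] C0_functions_mult) (auto simp: zero_set_def)
  qed auto
  then show ?thesis
    unfolding C0_z_ideal_def using up mem by blast
qed

text \<open>Primeness comes from the zero set of a product being the union of the zero sets.
  Properness needs a witness: nonzero constants do not vanish at infinity on a noncompact space, so
  a function with zero set \<open>topspace X - V\<close> is used instead.\<close>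

lemma C0_prime_ideal_z_inverse:
  assumes P: "prime_z_filter TYPE('k::real_normed_field) X P"
    and X: "metrizable_space X" and K: "compactin X K" "openin X V" "V \<subseteq> K"
    and nV: "topspace X - V \<notin> P"
  shows "C0_prime_ideal X (C0_functions X \<inter> (z_inverse X P :: ('a \<Rightarrow> 'k) set))"
proof -
  let ?I = "C0_functions X \<inter> (z_inverse X P :: ('a \<Rightarrow> 'k) set)"
  have mem: "f \<in> ?I \<longleftrightarrow> f \<in> C0_functions X \<and> zero_set X f \<in> P" for f
    by (auto simp: z_inverse_def C0_functions_def)
  have F: "z_filter TYPE('k) X P" using P by (simp add: prime_z_filter_def)
  have "closedin X (topspace X - V)" "topspace X - K \<subseteq> topspace X - V"
    using K by auto
  then obtain h :: "'a \<Rightarrow> 'k" where "h \<in> C0_functions X" "zero_set X h = topspace X - V"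
    using C0_function_with_zero_set[OF X _ K(1)] by blast
  with nV mem have "?I \<noteq> C0_functions X" by metis
  moreover have "f \<in> ?I \<or> g \<in> ?I" if f: "f \<in> C0_functions X" and g: "g \<in> C0_functions X"
    and fg: "(\<lambda>x\<in>topspace X. f x * g x) \<in> ?I" for f g :: "'a \<Rightarrow> 'k"
  proof -
    have "zero_set X (\<lambda>x\<in>topspace X. f x * g x) = zero_set X f \<union> zero_set X g"
      by (auto simp: zero_set_def)
    then have "zero_set X f \<union> zero_set X g \<in> P" using fg mem by metis
    then have "zero_set X f \<in> P \<or> zero_set X g \<in> P"
      using P zero_set_in_zero_sets[OF f] zero_set_in_zero_sets[OF g]
      unfolding prime_z_filter_def by blast
    with f g mem show ?thesis by blast
  qed
  ultimately show ?thesis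
    using C0_z_ideal_z_inverse[OF F] unfolding C0_prime_ideal_def C0_z_ideal_def by blast
qed

subsection \<open>The chain of prime filters\<close>

text \<open>This labels the indices by binary sequences, and so by members of the almost disjoint
  family.\<close>

lemma card_continuum_imp_inj:
  assumes "|A| =o ctwo ^c natLeq"
  obtains \<tau> :: "'i \<Rightarrow> nat \<Rightarrow> bool" where "inj_on \<tau> A"
proof -
  have "ctwo ^c natLeq = |UNIV :: (nat \<Rightarrow> bool) set|"
    by (simp add: cexp_def ctwo_def Field_card_of Field_natLeq Func_def)
  with assms have "|A| \<le>o |UNIV :: (nat \<Rightarrow> bool) set|"
    by (metis ordIso_imp_ordLeq)
  then show thesis
    using that by (auto simp: card_of_ordLeq[symmetric])
qed

text \<open>The image of an ultrafilter under \<open>p\<close>, restricted to closed sets: primeness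
  is inherited from the dichotomy.\<close>

lemma prime_z_filter_ultrafilter:
  assumes X: "metrizable_space X" and "W \<noteq> bot"
    and ultra: "\<And>P. eventually P W \<or> eventually (\<lambda>y. \<not> P y) W"
    and p: "\<And>y. p y \<in> topspace X"
  shows "prime_z_filter TYPE('k::real_normed_field) X {C. closedin X C \<and> eventually (\<lambda>y. p y \<in> C) W}"
    (is "prime_z_filter _ _ ?Q")
proof -
  have top: "topspace X \<in> ?Q" using p by simp
  have empty: "{} \<notin> ?Q" using \<open>W \<noteq> bot\<close> by (simp add: trivial_limit_def)
  have union: "Z1 \<union> Z2 \<notin> ?Q" if "closedin X Z1" "closedin X Z2" "Z1 \<notin> ?Q" "Z2 \<notin> ?Q" for Z1 Z2
  proof
    assume "Z1 \<union> Z2 \<in> ?Q"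
    then have "eventually (\<lambda>y. p y \<in> Z1 \<union> Z2) W" by simp
    moreover have "eventually (\<lambda>y. p y \<notin> Z1) W" "eventually (\<lambda>y. p y \<notin> Z2) W"
      using that ultra by auto
    ultimately have "eventually (\<lambda>y. False) W" by eventually_elim auto
    with \<open>W \<noteq> bot\<close> show False by (simp add: trivial_limit_def)
  qed
  show ?thesis
    unfolding prime_z_filter_def z_filter_def zero_sets_eq_closed[OF X]
  proof (intro conjI ballI impI)
    show "?Q \<noteq> {}" using top by (metis empty_iff)
    show "?Q \<subset> {C. closedin X C}"
    proof
      show "?Q \<noteq> {C. closedin X C}" using empty closedin_empty[of X] by (metis mem_Collect_eq)
    qed auto
    show "Z1 \<inter> Z2 \<in> ?Q" if "Z1 \<in> ?Q" "Z2 \<in> ?Q" for Z1 Z2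
      using that by (auto intro: eventually_conj closedin_Int)
    show "Z2 \<in> ?Q" if "Z1 \<in> ?Q" "Z2 \<in> {C. closedin X C}" "Z1 \<subseteq> Z2" for Z1 Z2
      using that by (auto elim!: eventually_mono)
    show "Z1 \<union> Z2 \<notin> ?Q"
      if "Z1 \<in> {C. closedin X C} - ?Q" "Z2 \<in> {C. closedin X C} - ?Q" for Z1 Z2
      using that by (intro union) simp_all
  qed
qed

theorem theorem4p5:
  fixes \<Omega> :: "'a topology" and \<kappa> :: "'i rel"
  assumes "polish_topology \<Omega>"
    and "locally_compact_space \<Omega>"
    and "uncountable (topspace \<Omega>)"
    and "Well_order \<kappa>"
    and "|Field \<kappa>| =o ctwo ^c natLeq"
  shows "\<exists>\<Q> :: 'i \<Rightarrow> 'a set set.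
           (\<forall>\<alpha>\<in>Field \<kappa>. prime_z_filter TYPE('k::real_normed_field) \<Omega> (\<Q> \<alpha>)) \<and>
           decreasing_chain \<kappa> \<Q> \<and>
           (let Q = (\<lambda>\<alpha>. C0_functions \<Omega> \<inter> (z_inverse \<Omega> (\<Q> \<alpha>) :: ('a \<Rightarrow> 'k) set)) in
             (\<forall>\<alpha>\<in>Field \<kappa>. C0_prime_ideal \<Omega> (Q \<alpha>) \<and> C0_z_ideal \<Omega> (Q \<alpha>)) \<and>
             decreasing_chain \<kappa> Q)"
proof -
  have metr: "metrizable_space \<Omega>"
    using assms(1) by (simp add: polish_topology_def completely_metrizable_imp_metrizable_space)
  obtain V K where V: "openin \<Omega> V" "uncountable V" and K: "compactin \<Omega> K" "V \<subseteq> K"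
    using uncountable_open_in_compact[OF assms(1-3)] .
  obtain e :: "(nat \<Rightarrow> bool) \<Rightarrow> 'a" where eV: "range e \<subseteq> V"
    and cont: "\<And>U x. openin \<Omega> U \<Longrightarrow> e x \<in> U \<Longrightarrow> \<exists>m. \<forall>y. (\<forall>k<m. y k = x k) \<longrightarrow> e y \<in> U"
    and emb: "\<And>x m. \<exists>U. openin \<Omega> U \<and> e x \<in> U \<and> (\<forall>y. e y \<in> U \<longrightarrow> (\<forall>k<m. y k = x k))"
    by (rule Cantor_embedding[OF assms(1) V]) blast
  have eX: "e x \<in> topspace \<Omega>" for x
    using eV V(1) openin_subset by blast
  obtain N :: "(nat \<Rightarrow> bool) \<Rightarrow> nat set"
    where N: "\<And>t. infinite (N t)" "\<And>s t. s \<noteq> t \<Longrightarrow> finite (N s \<inter> N t)"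
    by (rule almost_disjoint_family) blast
  obtain \<tau> :: "'i \<Rightarrow> nat \<Rightarrow> bool" where \<tau>: "inj_on \<tau> (Field \<kappa>)"
    using card_continuum_imp_inj[OF assms(5)] .
  define Z where "Z \<alpha> = \<Omega> closure_of (e ` {x. \<forall>k\<in>N (\<tau> \<alpha>). \<not> x k})" for \<alpha>
  have closed_Z: "closedin \<Omega> (Z \<alpha>)" for \<alpha> by (simp add: Z_def)
  \<comment> \<open>The closure adds no new points of the image of \<open>e\<close>, because
    \<open>e\<close> is an embedding.\<close>
  have Z: "e x \<in> Z \<alpha> \<longleftrightarrow> (\<forall>k\<in>N (\<tau> \<alpha>). \<not> x k)" for \<alpha> x
  proof
    assume "\<forall>k\<in>N (\<tau> \<alpha>). \<not> x k"
    then show "e x \<in> Z \<alpha>"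
      unfolding Z_def using eX by (intro subsetD[OF closure_of_subset]) auto
  next
    assume "e x \<in> Z \<alpha>"
    show "\<forall>k\<in>N (\<tau> \<alpha>). \<not> x k"
    proof (intro ballI notI)
      fix k assume k: "k \<in> N (\<tau> \<alpha>)" "x k"
      \<comment> \<open>\<open>Suc k\<close> makes the neighborhood determine coordinate
        \<open>k\<close> itself.\<close>
      obtain U where U: "openin \<Omega> U" "e x \<in> U" "\<And>y. e y \<in> U \<Longrightarrow> \<forall>j<Suc k. y j = x j"
        using emb[of x "Suc k"] by blast
      obtain y where "\<forall>k\<in>N (\<tau> \<alpha>). \<not> y k" "e y \<in> U"
        using \<open>e x \<in> Z \<alpha>\<close> U(1,2) unfolding Z_def in_closure_of by blast
      with U(3) k show False by blast
    qed
  qed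
  obtain W :: "('i \<Rightarrow> nat \<Rightarrow> bool) filter" where W: "W \<noteq> bot"
    and ultra: "\<And>P. eventually P W \<or> eventually (\<lambda>y. \<not> P y) W"
    and in_Z: "\<And>\<alpha>. \<alpha> \<in> Field \<kappa> \<Longrightarrow> eventually (\<lambda>y. e (y \<alpha>) \<in> Z \<alpha>) W"
    and notin_Z: "\<And>\<alpha> \<beta>. (\<alpha>, \<beta>) \<in> \<kappa> \<Longrightarrow> \<alpha> \<noteq> \<beta> \<Longrightarrow> eventually (\<lambda>y. e (y \<beta>) \<notin> Z \<alpha>) W"
    and opens: "\<And>\<alpha> \<beta> U. (\<alpha>, \<beta>) \<in> \<kappa> \<Longrightarrow> \<alpha> \<noteq> \<beta> \<Longrightarrow> openin \<Omega> U \<Longrightarrow>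
      eventually (\<lambda>y. e (y \<alpha>) \<in> U \<longrightarrow> e (y \<beta>) \<in> U) W"
  proof (rule ultrafilter_of_approximating_families[where r = \<kappa> and
        N = "\<lambda>\<alpha>. N (\<tau> \<alpha>)" and e = e and X = \<Omega> and Z = Z])
    show "finite (N (\<tau> \<alpha>) \<inter> N (\<tau> \<beta>))"
      if "\<alpha> \<in> Field \<kappa>" "\<beta> \<in> Field \<kappa>" "\<alpha> \<noteq> \<beta>" for \<alpha> \<beta>
      using that \<tau> by (intro N(2)) (auto dest: inj_onD)
  qed (use assms(4) N(1) cont Z in auto)
  define \<Q> where "\<Q> \<alpha> = {C. closedin \<Omega> C \<and> eventually (\<lambda>y. e (y \<alpha>) \<in> C) W}" for \<alpha>
  have not_both: False if "eventually P W" "eventually (\<lambda>y. \<not> P y) W" for P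
    using eventually_conj[OF that] W by (simp add: trivial_limit_def)
  have prime: "prime_z_filter TYPE('k) \<Omega> (\<Q> \<alpha>)" for \<alpha>
    unfolding \<Q>_def by (rule prime_z_filter_ultrafilter[OF metr W ultra]) (rule eX)
  have mono: "\<Q> \<beta> \<subseteq> \<Q> \<alpha>" if "(\<alpha>, \<beta>) \<in> \<kappa>" "\<alpha> \<noteq> \<beta>" for \<alpha> \<beta>
  proof
    fix C assume C: "C \<in> \<Q> \<beta>"
    \<comment> \<open>The open-set condition is used in contrapositive form, for the complement of
      \<open>C\<close>.\<close>
    have "openin \<Omega> (topspace \<Omega> - C)" using C by (auto simp: \<Q>_def)
    from opens[OF that this] have "eventually (\<lambda>y. e (y \<alpha>) \<notin> C \<longrightarrow> e (y \<beta>) \<notin> C) W"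
      by eventually_elim (use eX in auto)
    moreover have "eventually (\<lambda>y. e (y \<beta>) \<in> C) W" using C by (simp add: \<Q>_def)
    ultimately have "eventually (\<lambda>y. e (y \<alpha>) \<in> C) W" by eventually_elim auto
    with C show "C \<in> \<Q> \<alpha>" by (simp add: \<Q>_def)
  qed
  have outside: "topspace \<Omega> - V \<notin> \<Q> \<alpha>" for \<alpha>
  proof
    assume "topspace \<Omega> - V \<in> \<Q> \<alpha>"
    then have "eventually (\<lambda>y. e (y \<alpha>) \<notin> V) W"
      by (auto simp: \<Q>_def elim: eventually_mono)
    moreover have "eventually (\<lambda>y. e (y \<alpha>) \<in> V) W" using eV by (intro always_eventually) auto
    ultimately show False by (rule not_both[rotated])
  qed
  \<comment> \<open>One function gives strictness of both chains: its zero set distinguishes the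
    filters, and the function itself the ideals.\<close>
  have separating: "\<exists>f\<in>C0_functions \<Omega> :: ('a \<Rightarrow> 'k) set. zero_set \<Omega> f \<in> \<Q> \<alpha> - \<Q> \<beta>"
    if "(\<alpha>, \<beta>) \<in> \<kappa>" "\<alpha> \<noteq> \<beta>" for \<alpha> \<beta>
  proof -
    \<comment> \<open>\<open>Z \<alpha>\<close> alone need not be the zero set of a function in
      \<open>C0_functions \<Omega>\<close>. Adding the complement of \<open>V\<close> makes it one
      and changes no membership of points of \<open>range e\<close>, which lies in
      \<open>V\<close>.\<close>
    let ?D = "Z \<alpha> \<union> (topspace \<Omega> - V)"
    have D: "closedin \<Omega> ?D" using closed_Z V by (intro closedin_Un) auto
    moreover have "topspace \<Omega> - K \<subseteq> ?D" using K by auto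
    ultimately obtain f :: "'a \<Rightarrow> 'k" where f: "f \<in> C0_functions \<Omega>" "zero_set \<Omega> f = ?D"
      using C0_function_with_zero_set[OF metr _ K(1)] by metis
    have "\<alpha> \<in> Field \<kappa>" using that by (auto simp: Field_def)
    then have "eventually (\<lambda>y. e (y \<alpha>) \<in> ?D) W"
      by (intro eventually_mono[OF in_Z]) auto
    moreover have "eventually (\<lambda>y. e (y \<beta>) \<notin> ?D) W"
      using notin_Z[OF that] by eventually_elim (use eV in auto)
    then have "\<not> eventually (\<lambda>y. e (y \<beta>) \<in> ?D) W"
      using not_both by blast
    ultimately have "?D \<in> \<Q> \<alpha> - \<Q> \<beta>" using D by (simp add: \<Q>_def)
    with f show ?thesis by metis
  qed
  define Q where "Q = (\<lambda>\<alpha>. C0_functions \<Omega> \<inter> (z_inverse \<Omega> (\<Q> \<alpha>) :: ('a \<Rightarrow> 'k) set))"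
  have "\<forall>\<alpha>\<in>Field \<kappa>. prime_z_filter TYPE('k) \<Omega> (\<Q> \<alpha>)"
    using prime by blast
  moreover have "decreasing_chain \<kappa> \<Q>"
    unfolding decreasing_chain_def using mono separating by (metis DiffE psubsetI)
  moreover have "C0_prime_ideal \<Omega> (Q \<alpha>) \<and> C0_z_ideal \<Omega> (Q \<alpha>)" for \<alpha>
    unfolding Q_def
    using C0_prime_ideal_z_inverse[OF prime metr K(1) V(1) K(2) outside]
      C0_z_ideal_z_inverse prime unfolding prime_z_filter_def by blast
  moreover have "decreasing_chain \<kappa> Q"
    unfolding decreasing_chain_def
  proof (intro allI impI, elim conjE)
    fix \<alpha> \<beta> assume \<alpha>\<beta>: "(\<alpha>, \<beta>) \<in> \<kappa>" "\<alpha> \<noteq> \<beta>"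
    have mem: "f \<in> Q \<gamma> \<longleftrightarrow> f \<in> C0_functions \<Omega> \<and> zero_set \<Omega> f \<in> \<Q> \<gamma>" for f \<gamma>
      by (auto simp: Q_def z_inverse_def C0_functions_def)
    show "Q \<beta> \<subset> Q \<alpha>"
      using mono[OF \<alpha>\<beta>] separating[OF \<alpha>\<beta>] mem by blast
  qed
  ultimately show ?thesis
    unfolding Let_def Q_def by blast
qed

end
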